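(* Let $G,H\in\mathcal{RH}_\infty^{m\times m}$ with $H$ invertible. The closed-loop system $G(s)\#H(s)$ is stable if, for each $\omega\in[0,\infty)$, $$P(G(j\omega))\cap P\!\left(-\tfrac1\tau H^{-1}(j\omega)\right)=\varnothing\quad\text{for all }\tau\in(0,1].$$ Moreover, at any $\omega\in[0,\infty)$, the displayed condition at that $\omega$ implies $$DW(G(j\omega))\cap DW\!\left(-\tfrac1\tau H^{-1}(j\omega)\right)=\varnothing\quad\text{for all }\tau\in(0,1].$$
   Context: $\mathcal{RH}_\infty^{m\times m}$ is the set of real, rational, proper, stable $m\times m$ transfer function matrices. $H^{-1}(j\omega)$ denotes the inverse of $H$ evaluated at $j\omega$. For $G,H\in\mathcal{RH}_\infty^{m\times m}$, the standard (negative) feedback interconnection is described by $$G\#H=\begin{bmatrix}(I+HG)^{-1} & (I+HG)^{-1}H\\ G(I+HG)^{-1} & G(I+HG)^{-1}H\end{bmatrix},$$ and the closed-loop system is called stable if $G\#H\in\mathcal{RH}_\infty^{2m\times 2m}$. For $A\in\mathbb{C}^{n\times n}$, the Davis-Wielandt (DW) shell is $DW(A)=\{(x^*Ax,\|Ax\|^2): x\in\mathbb{C}^n,\|x\|=1\}\subset\mathbb{C}\times\mathbb{R}$ (Euclidean norm), and the $x$-$z$ graph is its projection onto the $x$-$z$ plane ($\mathbb{C}$ being identified with the $x$-$y$ plane), $P(A)=\{(\Re(x^*Ax),\|Ax\|^2): x\in\mathbb{C}^n,\|x\|=1\}\subset\mathbb{R}^2$.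
   Formalization: The stability claim also assumes I+τHG is invertible with proper inverse (nonsingular at ω=∞) for every τ∈(0,1]; without it H=1, G=-2s/(s+1) is a counterexample. The condition at ω includes that H(jω) is invertible, so that H^{-1}(jω) exists. *)

theory Defs
  imports
    "HOL-Analysis.Analysis"
    "HOL-Computational_Algebra.Computational_Algebra"
    "HOL-Computational_Algebra.Field_as_Ring"
begin

(* Field_as_Ring supplies the trivial gcd on real that quot_of_fract requires. *)
type_synonym ratfun = "real poly fract"

abbreviation cpoly :: "real poly \<Rightarrow> complex poly" where
  "cpoly \<equiv> map_poly complex_of_real"

(* quot_of_fract returns the representation in lowest terms, so removable singularities do not
   matter; at a pole the value is 0 by the convention z / 0 = 0. *)
definition rf_eval :: "ratfun \<Rightarrow> complex \<Rightarrow> complex" where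
  "rf_eval r s = poly (cpoly (fst (quot_of_fract r))) s / poly (cpoly (snd (quot_of_fract r))) s"

definition rf_proper :: "ratfun \<Rightarrow> bool" where
  "rf_proper r \<longleftrightarrow> degree (fst (quot_of_fract r)) \<le> degree (snd (quot_of_fract r))"

(* No pole in the closed right half-plane. *)
definition rf_stable :: "ratfun \<Rightarrow> bool" where
  "rf_stable r \<longleftrightarrow> (\<forall>s. Re s \<ge> 0 \<longrightarrow> poly (cpoly (snd (quot_of_fract r))) s \<noteq> 0)"

definition RH_inf :: "(ratfun ^ 'n::finite ^ 'n) set" where
  "RH_inf = {G. \<forall>i j. rf_proper (G $ i $ j) \<and> rf_stable (G $ i $ j)}"

definition tf_eval :: "ratfun ^ 'n ^ 'n \<Rightarrow> complex \<Rightarrow> complex ^ 'n ^ 'n::finite" where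
  "tf_eval G s = (\<chi> i j. rf_eval (G $ i $ j) s)"

definition tf_scale :: "real \<Rightarrow> ratfun ^ 'n ^ 'n \<Rightarrow> ratfun ^ 'n ^ 'n::finite" where
  "tf_scale \<tau> G = (\<chi> i j. to_fract [:\<tau>:] * G $ i $ j)"

definition block_matrix ::
  "'a ^ 'n ^ 'n \<Rightarrow> 'a ^ 'n ^ 'n \<Rightarrow> 'a ^ 'n ^ 'n \<Rightarrow> 'a ^ 'n ^ 'n \<Rightarrow> 'a ^ ('n + 'n) ^ ('n::finite + 'n)" where
  "block_matrix A B C D =
     (\<chi> i j. case i of
        Inl k \<Rightarrow> (case j of Inl l \<Rightarrow> A $ k $ l | Inr l \<Rightarrow> B $ k $ l)
      | Inr k \<Rightarrow> (case j of Inl l \<Rightarrow> C $ k $ l | Inr l \<Rightarrow> D $ k $ l))"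

definition feedback :: "ratfun ^ 'n ^ 'n \<Rightarrow> ratfun ^ 'n ^ 'n \<Rightarrow> ratfun ^ ('n + 'n) ^ ('n::finite + 'n)" where
  "feedback G H =
     (let S = matrix_inv (mat 1 + H ** G)
      in block_matrix S (S ** H) (G ** S) (G ** S ** H))"

(* Invertibility over the field of rational functions is required explicitly, because
   matrix_inv is unspecified on a singular matrix. *)
definition closed_loop_stable :: "ratfun ^ 'n ^ 'n \<Rightarrow> ratfun ^ 'n ^ 'n::finite \<Rightarrow> bool" where
  "closed_loop_stable G H \<longleftrightarrow> invertible (mat 1 + H ** G) \<and> feedback G H \<in> RH_inf"

(* For proper G and H this says that I + H(\<infinity>) G(\<infinity>) is nonsingular. A separation condition at
   finite frequencies only does not control this point: G = -2s/(s+1) and H = 1 have disjoint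
   x-z graphs for all finite frequencies and all \<tau> in (0,1], yet 1/(1+G) = (s+1)/(1-s) is unstable
   (the loop with \<tau> = 1/2 is ill-posed). *)
definition well_posed :: "ratfun ^ 'n ^ 'n \<Rightarrow> ratfun ^ 'n ^ 'n::finite \<Rightarrow> bool" where
  "well_posed G H \<longleftrightarrow> invertible (mat 1 + H ** G) \<and>
     (\<forall>i j. rf_proper (matrix_inv (mat 1 + H ** G) $ i $ j))"

definition quad_form :: "complex ^ 'n ^ 'n \<Rightarrow> complex ^ 'n::finite \<Rightarrow> complex" where
  "quad_form A x = (\<Sum>i\<in>UNIV. cnj (x $ i) * (A *v x) $ i)"

definition DW :: "complex ^ 'n ^ 'n::finite \<Rightarrow> (complex \<times> real) set" where
  "DW A = {(quad_form A x, (norm (A *v x))\<^sup>2) | x. norm x = 1}"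

definition xz_graph :: "complex ^ 'n ^ 'n::finite \<Rightarrow> (real \<times> real) set" where
  "xz_graph A = {(Re (quad_form A x), (norm (A *v x))\<^sup>2) | x. norm x = 1}"

end

theory Submission imports Defs begin

text \<open>
  If I + t H G is singular at a point of the imaginary axis, then some unit vector x satisfies
  G x = - (1/t) H^-1 x there, so the two x-z graphs meet. Under the separation condition
  det (I + t H G) = p t / q, with q a fixed Hurwitz polynomial, therefore has no zero on the
  imaginary axis for any t in [0,1] (negative frequencies follow by conjugation), and by
  well-posedness p t keeps the degree of q. The zeros cannot leave the left half-plane as t runs
  from 0, where p 0 = q, to 1: the set of t with all zeros in the left half-plane is described by
  the closed conditions |lc (p t)| (Re z)^N \<le> |p t z| for Re z > 0, and its complement is closed
  by compactness, since the zeros are uniformly bounded. Hence p 1 is Hurwitz, and by Cramer's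
  rule (I + H G)^-1 is proper and stable.
\<close>

section \<open>Zeros of a path of polynomials\<close>

text \<open>Split p into linear factors: every root r gives |s - r| \<ge> Re (s - r) \<ge> Re s.
  Unlike the mere absence of zeros, this inequality survives limits of polynomials of one fixed
  degree.\<close>

lemma norm_poly_ge_of_roots_left:
  fixes p :: "complex poly"
  assumes roots: "\<And>r. poly p r = 0 \<Longrightarrow> Re r \<le> 0" and s: "Re s > 0"
  shows "cmod (lead_coeff p) * Re s ^ degree p \<le> cmod (poly p s)"
proof (cases "p = 0")
  case False
  obtain root where eq: "smult (lead_coeff p) (\<Prod>i<degree p. [:-root i, 1:]) = p"
    by (rule complex_poly_decompose')
  have ev: "poly p z = lead_coeff p * (\<Prod>i<degree p. z - root i)" for z
    by (subst eq[symmetric]) (simp add: poly_prod)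
  have "Re s \<le> cmod (s - root i)" if "i < degree p" for i
  proof -
    have "poly p (root i) = 0"
      unfolding ev using that by (auto intro: prod_zero)
    then have "Re s \<le> Re (s - root i)"
      using roots by fastforce
    then show ?thesis
      using complex_Re_le_cmod order_trans by blast
  qed
  then have "(\<Prod>i<degree p. Re s) \<le> (\<Prod>i<degree p. cmod (s - root i))"
    using s by (intro prod_mono) auto
  then show ?thesis
    unfolding ev by (auto simp: norm_mult prod_norm intro!: mult_left_mono)
qed auto

text \<open>Outside the unit disc every lower power is at most |s|^n, where
  \<open>degree p = Suc n\<close>; isolating the leading term and cancelling |s|^n gives the bound.
  It depends continuously on the coefficients as long as the leading one stays nonzero.\<close>

lemma cauchy_root_bound:
  fixes p :: "complex poly"
  assumes "p \<noteq> 0" "poly p s = 0"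
  shows "cmod s \<le> 1 + (\<Sum>i<degree p. cmod (coeff p i)) / cmod (lead_coeff p)"
proof (cases "cmod s \<le> 1")
  case True
  then show ?thesis
    by (smt (verit) divide_nonneg_nonneg norm_ge_zero sum_nonneg)
next
  case False
  obtain n where n: "degree p = Suc n"
  proof (cases "degree p")
    case 0
    then obtain c where "p = [:c:]" using degree_0_id by metis
    with assms show ?thesis by simp
  qed auto
  define S where "S = (\<Sum>i<degree p. cmod (coeff p i))"
  have "lead_coeff p * s ^ degree p = - (\<Sum>i<degree p. coeff p i * s ^ i)"
    using assms(2) unfolding poly_altdef
    by (simp add: lessThan_Suc_atMost[symmetric] add_eq_0_iff)
  then have "cmod (lead_coeff p) * cmod s ^ degree p = cmod (\<Sum>i<degree p. coeff p i * s ^ i)"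
    by (metis norm_minus_cancel norm_mult norm_power)
  also have "\<dots> \<le> (\<Sum>i<degree p. cmod (coeff p i) * cmod s ^ n)"
    using False n
    by (intro sum_norm_le) (auto simp: norm_mult norm_power intro!: mult_left_mono power_increasing)
  also have "\<dots> = S * cmod s ^ n"
    by (simp add: S_def sum_distrib_right)
  finally have "(cmod (lead_coeff p) * cmod s) * cmod s ^ n \<le> S * cmod s ^ n"
    by (simp add: n mult_ac)
  moreover have "cmod s ^ n > 0"
    using False by (intro zero_less_power) linarith
  ultimately have "cmod (lead_coeff p) * cmod s \<le> S"
    using mult_le_cancel_right_pos by blast
  then have "cmod s \<le> S / cmod (lead_coeff p)"
    using assms(1) by (simp add: pos_le_divide_eq mult.commute)
  then show ?thesis by (simp add: S_def)
qed

lemma hurwitz_homotopy: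
  fixes p :: "real \<Rightarrow> complex poly"
  assumes cont: "\<And>n. continuous_on {0..1} (\<lambda>t. coeff (p t) n)"
    and deg: "\<And>t. t \<in> {0..1} \<Longrightarrow> p t \<noteq> 0 \<and> degree (p t) = N"
    and axis: "\<And>t s. t \<in> {0..1} \<Longrightarrow> Re s = 0 \<Longrightarrow> poly (p t) s \<noteq> 0"
    and start: "\<And>s. 0 \<le> Re s \<Longrightarrow> poly (p 0) s \<noteq> 0"
    and s: "0 \<le> Re s"
  shows "poly (p 1) s \<noteq> 0"
proof -
  let ?I = "{0..1::real}"
  have ev: "poly (p t) z = (\<Sum>i\<le>N. coeff (p t) i * z ^ i)" if "t \<in> ?I" for t z
    using deg[OF that] by (auto simp: poly_altdef)
  have lc: "coeff (p t) N \<noteq> 0" if "t \<in> ?I" for t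
    using deg[OF that] leading_coeff_neq_0 by blast

  \<comment> \<open>Each constraint is a non-strict inequality between continuous functions of t,
    hence closed. Summing up to the constant degree N lets t enter through the coefficients
    alone.\<close>
  define A where "A = (\<Inter>z\<in>{z. Re z > 0}.
    {t \<in> ?I. cmod (coeff (p t) N) * Re z ^ N \<le> cmod (\<Sum>i\<le>N. coeff (p t) i * z ^ i)})"
  have "closed A"
    unfolding A_def
    by (intro closed_INT ballI continuous_on_closed_Collect_le continuous_intros cont)

  \<comment> \<open>The Cauchy bound for \<open>p t\<close>; its maximum over the compact interval
    bounds the zeros for all t at once.\<close>
  define b where "b t = 1 + (\<Sum>i<N. cmod (coeff (p t) i)) / cmod (coeff (p t) N)" for t
  have "continuous_on ?I b"
    unfolding b_def using lc by (intro continuous_intros cont) auto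
  then have "bdd_above (b ` ?I)"
    by (intro bounded_imp_bdd_above compact_imp_bounded compact_continuous_image) auto
  then obtain R where R: "\<And>t. t \<in> ?I \<Longrightarrow> b t \<le> R"
    unfolding bdd_above_def by blast
  define K where "K = {z. 0 \<le> Re z} \<inter> cball 0 R"
  have "compact K"
    unfolding K_def by (intro closed_Int_compact closed_halfspace_Re_ge compact_cball)
  \<comment> \<open>Pairs of a parameter and a zero in the closed right half-plane. The ball of
    radius R loses no such zero and makes \<open>Z\<close> compact, so its projection to the
    parameters is closed.\<close>
  define Z where "Z = {x \<in> ?I \<times> K. (\<Sum>i\<le>N. coeff (p (fst x)) i * snd x ^ i) = 0}"
  have cont': "continuous_on (?I \<times> K) (\<lambda>x. coeff (p (fst x)) i)" for i
    by (rule continuous_on_compose2[OF cont]) (auto intro: continuous_intros)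
  have "closed Z"
    unfolding Z_def using \<open>compact K\<close>
    by (intro continuous_closed_preimage_constant continuous_intros cont' closed_Times)
       (auto intro: compact_imp_closed)
  then have "compact (Z \<inter> ?I \<times> K)"
    using \<open>compact K\<close> by (intro closed_Int_compact compact_Times) auto
  moreover have "Z \<inter> ?I \<times> K = Z" by (auto simp: Z_def)
  ultimately have "compact (fst ` Z)"
    by (auto intro!: compact_continuous_image continuous_intros)
  then have "closed (fst ` Z)" by (rule compact_imp_closed)

  have Z_iff: "t \<in> fst ` Z \<longleftrightarrow> (\<exists>z. 0 \<le> Re z \<and> poly (p t) z = 0)" if t: "t \<in> ?I" for t
  proof
    assume "\<exists>z. 0 \<le> Re z \<and> poly (p t) z = 0"
    then obtain z where z: "0 \<le> Re z" "poly (p t) z = 0" by blast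
    have "cmod z \<le> b t"
      using cauchy_root_bound[OF _ z(2)] deg[OF t] unfolding b_def by auto
    then have "(t, z) \<in> Z"
      using R[OF t] z t ev[OF t] by (auto simp: Z_def K_def)
    then show "t \<in> fst ` Z" by force
  qed (use ev t in \<open>force simp: Z_def K_def\<close>)
  have A_iff: "t \<in> A \<longleftrightarrow> \<not> (\<exists>z. 0 \<le> Re z \<and> poly (p t) z = 0)" if t: "t \<in> ?I" for t
  proof
    assume A: "t \<in> A"
    show "\<not> (\<exists>z. 0 \<le> Re z \<and> poly (p t) z = 0)"
    proof
      assume "\<exists>z. 0 \<le> Re z \<and> poly (p t) z = 0"
      then obtain z where z: "0 \<le> Re z" "poly (p t) z = 0" by blast
      \<comment> \<open>The bound in \<open>A\<close> speaks only of Re z > 0; a zero with Re z = 0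
        has to be excluded by \<open>axis\<close>.\<close>
      then have "Re z > 0" using axis[OF t, of z] by force
      then have "cmod (coeff (p t) N) * Re z ^ N \<le> 0"
        using A z ev[OF t, of z] by (auto simp: A_def)
      then show False
        using lc[OF t] zero_less_power[OF \<open>Re z > 0\<close>, of N] by (simp add: mult_le_0_iff)
    qed
  next
    assume "\<not> (\<exists>z. 0 \<le> Re z \<and> poly (p t) z = 0)"
    then have "Re r \<le> 0" if "poly (p t) r = 0" for r
      using that by (meson linear)
    then have "cmod (coeff (p t) N) * Re z ^ N \<le> cmod (poly (p t) z)" if "Re z > 0" for z
      using norm_poly_ge_of_roots_left[of "p t" z] deg[OF t] that by auto
    then show "t \<in> A"
      using t by (simp add: A_def ev)
  qed
  \<comment> \<open>The interval is connected and covered by two disjoint closed sets,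
    \<open>A\<close> and the projection of \<open>Z\<close>. As \<open>A\<close> contains 0, the
    other one is empty.\<close>
  have "0 \<in> A \<inter> ?I" using start by (subst Int_iff, subst A_iff) auto
  moreover have "connected ?I" by simp
  moreover have "?I \<subseteq> A \<union> fst ` Z" "A \<inter> fst ` Z \<inter> ?I = {}"
    using A_iff Z_iff by blast+
  ultimately have "fst ` Z \<inter> ?I = {}"
    using \<open>closed A\<close> \<open>closed (fst ` Z)\<close> unfolding connected_closed by blast
  then show ?thesis using Z_iff[of 1] s by auto
qed

section \<open>Stable rational functions\<close>

lemma poly_cpoly_hom [simp]:
  "poly (cpoly (p + q)) s = poly (cpoly p) s + poly (cpoly q) s"
  "poly (cpoly (p * q)) s = poly (cpoly p) s * poly (cpoly q) s"
proof -
  show "poly (cpoly (p + q)) s = poly (cpoly p) s + poly (cpoly q) s"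
    unfolding poly_add[symmetric]
    by (rule arg_cong[where f = "\<lambda>p. poly p s"], rule poly_eqI) (simp add: coeff_map_poly)
  show "poly (cpoly (p * q)) s = poly (cpoly p) s * poly (cpoly q) s"
    unfolding poly_mult[symmetric]
    by (rule arg_cong[where f = "\<lambda>p. poly p s"], rule poly_eqI) (simp add: coeff_map_poly coeff_mult)
qed

lemma degree_cpoly [simp]: "degree (cpoly p) = degree p"
  by (rule degree_map_poly) auto

lemma poly_cpoly_cnj: "poly (cpoly p) (cnj s) = cnj (poly (cpoly p) s)"
  by (rule poly_cnj_real[symmetric]) (simp add: coeff_map_poly)

section \<open>Hurwitz polynomials and fractions not in lowest terms\<close>

definition hurwitz :: "real poly \<Rightarrow> bool" where
  "hurwitz p \<longleftrightarrow> (\<forall>s. Re s \<ge> 0 \<longrightarrow> poly (cpoly p) s \<noteq> 0)"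

lemma hurwitz_nonzero: "hurwitz p \<Longrightarrow> p \<noteq> 0"
  unfolding hurwitz_def by (metis map_poly_0 poly_0 order_refl zero_complex.sel(1))

lemma hurwitz_1: "hurwitz 1"
  by (simp add: hurwitz_def)

lemma hurwitz_mult: "hurwitz p \<Longrightarrow> hurwitz q \<Longrightarrow> hurwitz (p * q)"
  by (simp add: hurwitz_def)

lemma of_int_fract: "of_int k = Fract (of_int k) 1"
  by (cases k rule: int_cases2) (simp_all add: of_nat_fract)

lemma quot_of_fract_Fract_cross:
  fixes a b :: "real poly"
  assumes "b \<noteq> 0"
  shows "a * snd (quot_of_fract (Fract a b)) = fst (quot_of_fract (Fract a b)) * b"
  using Fract_quot_of_fract[of "Fract a b"] assms
  by (metis eq_fract(1) snd_quot_of_fract_nonzero)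

text \<open>By cross-multiplication the reduced denominator divides the reduced numerator times b,
  and coprimality removes the numerator. So its zeros are among those of any other
  denominator.\<close>

lemma snd_quot_of_fract_dvd:
  fixes a b :: "real poly"
  assumes "b \<noteq> 0"
  shows "snd (quot_of_fract (Fract a b)) dvd b"
proof -
  let ?q = "quot_of_fract (Fract a b)"
  have "coprime (snd ?q) (fst ?q)"
    using coprime_quot_of_fract coprime_commute by blast
  moreover have "snd ?q dvd fst ?q * b"
    by (metis quot_of_fract_Fract_cross[OF assms] dvd_triv_right)
  ultimately show ?thesis
    by (simp add: coprime_dvd_mult_right_iff)
qed

text \<open>The reduced denominator divides b, so it does not vanish at s either, and the
  cross-multiplied identity can be evaluated and divided. Later computations thus need no lowest
  terms.\<close>

lemma rf_eval_Fract:
  assumes "poly (cpoly b) s \<noteq> 0"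
  shows "rf_eval (Fract a b) s = poly (cpoly a) s / poly (cpoly b) s"
proof -
  let ?q = "quot_of_fract (Fract a b)"
  have "b \<noteq> 0" using assms by auto
  then obtain c where "b = snd ?q * c"
    using snd_quot_of_fract_dvd by blast
  then have "poly (cpoly (snd ?q)) s \<noteq> 0"
    using assms by (metis mult_zero_left poly_cpoly_hom(2))
  moreover have "poly (cpoly a) s * poly (cpoly (snd ?q)) s = poly (cpoly (fst ?q)) s * poly (cpoly b) s"
    using quot_of_fract_Fract_cross[OF \<open>b \<noteq> 0\<close>] by (metis poly_cpoly_hom(2))
  ultimately show ?thesis
    using assms by (simp add: rf_eval_def field_simps)
qed

lemma rf_stable_Fract: "hurwitz b \<Longrightarrow> rf_stable (Fract a b)"
  using snd_quot_of_fract_dvd[OF hurwitz_nonzero, of b a]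
  unfolding rf_stable_def hurwitz_def by (metis dvdE mult_zero_left poly_cpoly_hom(2))

lemma rf_stableE:
  assumes "rf_stable r"
  obtains a b where "hurwitz b" "r = Fract a b"
  using assms unfolding rf_stable_def hurwitz_def by (metis Fract_quot_of_fract)

text \<open>Cross-multiplication preserves the difference of the degrees. A zero numerator is
  treated apart, since its degree is 0 by convention and degrees then fail to add.\<close>

lemma rf_proper_Fract:
  assumes "b \<noteq> 0" "degree a \<le> degree b"
  shows "rf_proper (Fract a b)"
proof (cases "a = 0")
  case True
  then show ?thesis using assms by (simp add: rf_proper_def fract_collapse)
next
  case False
  let ?q = "quot_of_fract (Fract a b)"
  have "fst ?q \<noteq> 0"
    using False assms by (simp add: Zero_fract_def eq_fract)
  then have "degree a + degree (snd ?q) = degree (fst ?q) + degree b"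
    using quot_of_fract_Fract_cross[OF assms(1), of a] assms False
    by (metis degree_mult_eq snd_quot_of_fract_nonzero)
  then show ?thesis using assms by (simp add: rf_proper_def)
qed

text \<open>With the value 0 at poles, evaluation does not respect products in general. For stable
  functions the common denominator \<open>b * d\<close> is Hurwitz, so no pole interferes on the
  closed right half-plane.\<close>

lemma rf_stable_hom:
  assumes "rf_stable x" "rf_stable y"
  shows rf_stable_add: "rf_stable (x + y)" and rf_stable_mult: "rf_stable (x * y)"
    and rf_eval_add: "Re s \<ge> 0 \<Longrightarrow> rf_eval (x + y) s = rf_eval x s + rf_eval y s"
    and rf_eval_mult: "Re s \<ge> 0 \<Longrightarrow> rf_eval (x * y) s = rf_eval x s * rf_eval y s"
proof -
  obtain a b where x: "hurwitz b" "x = Fract a b" using assms(1) rf_stableE by blast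
  obtain c d where y: "hurwitz d" "y = Fract c d" using assms(2) rf_stableE by blast
  have nz: "b \<noteq> 0" "d \<noteq> 0" using x y hurwitz_nonzero by auto
  show "rf_stable (x + y)" "rf_stable (x * y)"
    using x y nz by (simp_all add: rf_stable_Fract hurwitz_mult)
  assume "Re s \<ge> 0"
  then have "poly (cpoly b) s \<noteq> 0" "poly (cpoly d) s \<noteq> 0" using x y by (auto simp: hurwitz_def)
  then show "rf_eval (x + y) s = rf_eval x s + rf_eval y s" "rf_eval (x * y) s = rf_eval x s * rf_eval y s"
    unfolding x y using nz by (simp_all add: rf_eval_Fract add_frac_eq)
qed

lemma rf_stable_const: "rf_stable (Fract [:c:] 1)"
  by (simp add: rf_stable_Fract hurwitz_1)

lemma rf_eval_const: "rf_eval (Fract [:c:] 1) s = of_real c"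
  by (simp add: rf_eval_Fract map_poly_pCons)

lemma of_int_fract_const: "(of_int k :: ratfun) = Fract [:of_int k:] 1"
  by (simp add: of_int_fract of_int_poly)

lemma rf_stable_of_int: "rf_stable (of_int k)"
  by (simp add: of_int_fract_const rf_stable_const)

lemma rf_eval_of_int: "rf_eval (of_int k) s = of_int k"
  by (simp add: of_int_fract_const rf_eval_const)

lemma rf_sum_hom:
  assumes "\<And>i. i \<in> S \<Longrightarrow> rf_stable (f i)"
  shows rf_stable_sum: "rf_stable (sum f S)"
    and rf_eval_sum: "Re s \<ge> 0 \<Longrightarrow> rf_eval (sum f S) s = (\<Sum>i\<in>S. rf_eval (f i) s)"
proof -
  have "rf_stable (sum f S) \<and> (Re s \<ge> 0 \<longrightarrow> rf_eval (sum f S) s = (\<Sum>i\<in>S. rf_eval (f i) s))"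
    using assms rf_stable_of_int[of 0] rf_eval_of_int[of 0]
    by (induction S rule: infinite_finite_induct) (auto simp: rf_stable_add rf_eval_add)
  then show "rf_stable (sum f S)" "Re s \<ge> 0 \<Longrightarrow> rf_eval (sum f S) s = (\<Sum>i\<in>S. rf_eval (f i) s)"
    by auto
qed

lemma rf_prod_hom:
  assumes "\<And>i. i \<in> S \<Longrightarrow> rf_stable (f i)"
  shows rf_stable_prod: "rf_stable (prod f S)"
    and rf_eval_prod: "Re s \<ge> 0 \<Longrightarrow> rf_eval (prod f S) s = (\<Prod>i\<in>S. rf_eval (f i) s)"
proof -
  have "rf_stable (prod f S) \<and> (Re s \<ge> 0 \<longrightarrow> rf_eval (prod f S) s = (\<Prod>i\<in>S. rf_eval (f i) s))"
    using assms rf_stable_of_int[of 1] rf_eval_of_int[of 1]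
    by (induction S rule: infinite_finite_induct) (auto simp: rf_stable_mult rf_eval_mult)
  then show "rf_stable (prod f S)" "Re s \<ge> 0 \<Longrightarrow> rf_eval (prod f S) s = (\<Prod>i\<in>S. rf_eval (f i) s)"
    by auto
qed

text \<open>The Leibniz formula uses only sums, products and integer signs, all of which evaluation
  respects on stable entries.\<close>

lemma rf_eval_det:
  fixes M :: "ratfun ^ 'n ^ 'n::finite"
  assumes "\<And>i j. rf_stable (M $ i $ j)" "Re s \<ge> 0"
  shows "rf_eval (det M) s = det (tf_eval M s)"
  unfolding det_def
  using assms by (simp add: tf_eval_def rf_eval_sum rf_eval_mult rf_eval_prod rf_stable_mult rf_stable_prod
      rf_stable_of_int rf_eval_of_int)

section \<open>Families of proper rational functions\<close>

locale denominators =
  fixes B :: "real poly set"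
  assumes one_mem: "1 \<in> B" and mult_mem: "p \<in> B \<Longrightarrow> q \<in> B \<Longrightarrow> p * q \<in> B"
    and nonzero: "0 \<notin> B"
begin

text \<open>Taking all nonzero polynomials as denominators gives proper rational functions, taking the
  Hurwitz polynomials gives the proper stable ones. The denominator does not depend on the
  parameter, so the zeros of a member of the family are governed by one polynomial whose
  coefficients are continuous in the parameter.\<close>

definition family :: "(real \<Rightarrow> ratfun) \<Rightarrow> bool" where
  "family f \<longleftrightarrow> (\<exists>b\<in>B. \<exists>a. (\<forall>n. continuous_on UNIV (\<lambda>t. coeff (a t) n)) \<and>
     (\<forall>t. degree (a t) \<le> degree b \<and> f t = Fract (a t) b))"

lemma family_of_constants:
  assumes "continuous_on UNIV c"
  shows "family (\<lambda>t. Fract [:c t:] 1)"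
proof -
  have "continuous_on UNIV (\<lambda>t. coeff [:c t:] n)" for n
    using assms by (cases n) auto
  then show ?thesis
    unfolding family_def by (intro bexI[OF _ one_mem] exI[of _ "\<lambda>t. [:c t:]"]) auto
qed

lemma family_of_int: "family (\<lambda>_. of_int k)"
  using family_of_constants[of "\<lambda>_. of_int k"] by (simp add: of_int_fract_const)

lemma family_add:
  assumes "family f" "family g"
  shows "family (\<lambda>t. f t + g t)"
proof -
  obtain b a where f: "b \<in> B" "\<And>n. continuous_on UNIV (\<lambda>t. coeff (a t) n)"
    "\<And>t. degree (a t) \<le> degree b" "\<And>t. f t = Fract (a t) b"
    using assms(1) unfolding family_def by blast
  obtain d c where g: "d \<in> B" "\<And>n. continuous_on UNIV (\<lambda>t. coeff (c t) n)"
    "\<And>t. degree (c t) \<le> degree d" "\<And>t. g t = Fract (c t) d"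
    using assms(2) unfolding family_def by blast
  have nz: "b \<noteq> 0" "d \<noteq> 0" using f g nonzero by auto
  show ?thesis
    unfolding family_def
  proof (intro bexI exI conjI allI)
    show "b * d \<in> B" using f g mult_mem by blast
    show "continuous_on UNIV (\<lambda>t. coeff (a t * d + c t * b) n)" for n
      by (auto simp: coeff_mult intro!: continuous_intros f g)
    fix t
    \<comment> \<open>Properness survives because degrees add exactly for the nonzero
      denominators.\<close>
    have "degree (a t * d) \<le> degree b + degree d" "degree (c t * b) \<le> degree b + degree d"
      using degree_mult_le[of "a t" d] f(3)[of t] degree_mult_le[of "c t" b] g(3)[of t] by linarith+
    then show "degree (a t * d + c t * b) \<le> degree (b * d)"
      using nz by (simp add: degree_mult_eq degree_add_le)
    show "f t + g t = Fract (a t * d + c t * b) (b * d)"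
      using f g nz by simp
  qed
qed

lemma family_mult:
  assumes "family f" "family g"
  shows "family (\<lambda>t. f t * g t)"
proof -
  obtain b a where f: "b \<in> B" "\<And>n. continuous_on UNIV (\<lambda>t. coeff (a t) n)"
    "\<And>t. degree (a t) \<le> degree b" "\<And>t. f t = Fract (a t) b"
    using assms(1) unfolding family_def by blast
  obtain d c where g: "d \<in> B" "\<And>n. continuous_on UNIV (\<lambda>t. coeff (c t) n)"
    "\<And>t. degree (c t) \<le> degree d" "\<And>t. g t = Fract (c t) d"
    using assms(2) unfolding family_def by blast
  have nz: "b \<noteq> 0" "d \<noteq> 0" using f g nonzero by auto
  show ?thesis
    unfolding family_def
  proof (intro bexI exI conjI allI)
    show "b * d \<in> B" using f g mult_mem by blast
    show "continuous_on UNIV (\<lambda>t. coeff (a t * c t) n)" for n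
      by (auto simp: coeff_mult intro!: continuous_intros f g)
    fix t
    show "degree (a t * c t) \<le> degree (b * d)"
      using nz degree_mult_le[of "a t" "c t"] f(3)[of t] g(3)[of t] by (simp add: degree_mult_eq)
    show "f t * g t = Fract (a t * c t) (b * d)"
      using f g by simp
  qed
qed

lemma family_sum:
  assumes "\<And>i. i \<in> S \<Longrightarrow> family (f i)"
  shows "family (\<lambda>t. \<Sum>i\<in>S. f i t)"
  using assms family_of_int[of 0]
  by (induction S rule: infinite_finite_induct) (auto simp: family_add)

lemma family_prod:
  assumes "\<And>i. i \<in> S \<Longrightarrow> family (f i)"
  shows "family (\<lambda>t. \<Prod>i\<in>S. f i t)"
  using assms family_of_int[of 1]
  by (induction S rule: infinite_finite_induct) (auto simp: family_mult)

lemma family_det: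
  fixes M :: "real \<Rightarrow> ratfun ^ 'n ^ 'n::finite"
  assumes "\<And>i j. family (\<lambda>t. M t $ i $ j)"
  shows "family (\<lambda>t. det (M t))"
  unfolding det_def
  by (intro family_sum family_mult family_of_int family_prod assms)

lemma family_const_iff: "family (\<lambda>_. r) \<longleftrightarrow> (\<exists>b\<in>B. \<exists>a. degree a \<le> degree b \<and> r = Fract a b)"
proof
  assume "\<exists>b\<in>B. \<exists>a. degree a \<le> degree b \<and> r = Fract a b"
  then obtain b a where "b \<in> B" "degree a \<le> degree b" "r = Fract a b" by blast
  then show "family (\<lambda>_. r)"
    unfolding family_def by (intro bexI[of _ b] exI[of _ "\<lambda>_. a"]) auto
qed (auto simp: family_def)

end

interpretation proper: denominators "{p. p \<noteq> 0}"
  by unfold_locales auto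

interpretation RH: denominators "Collect hurwitz"
  by unfold_locales (use hurwitz_nonzero in \<open>auto simp: hurwitz_1 hurwitz_mult\<close>)

lemma proper_const_iff: "proper.family (\<lambda>_. r) \<longleftrightarrow> rf_proper r"
proof
  assume "rf_proper r"
  then show "proper.family (\<lambda>_. r)"
    unfolding proper.family_const_iff rf_proper_def
    by (intro bexI[of _ "snd (quot_of_fract r)"] exI[of _ "fst (quot_of_fract r)"]) auto
qed (auto simp: proper.family_const_iff rf_proper_Fract)

text \<open>Stability says that the reduced denominator is Hurwitz, and the reduced denominator
  divides every other one. Entries of \<open>RH_inf\<close> matrices thus become constant families,
  and closure under sums, products and determinants applies to them.\<close>

lemma RH_const_iff: "RH.family (\<lambda>_. r) \<longleftrightarrow> rf_proper r \<and> rf_stable r"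
proof
  assume "rf_proper r \<and> rf_stable r"
  then show "RH.family (\<lambda>_. r)"
    unfolding RH.family_const_iff rf_proper_def rf_stable_def
    by (intro bexI[of _ "snd (quot_of_fract r)"] exI[of _ "fst (quot_of_fract r)"])
       (auto simp: hurwitz_def)
qed (auto simp: RH.family_const_iff rf_proper_Fract rf_stable_Fract hurwitz_nonzero)

section \<open>The feedback loop\<close>

lemma tf_eval_mult:
  fixes M N :: "ratfun ^ 'n ^ 'n::finite"
  assumes "\<And>i j. rf_stable (M $ i $ j)" "\<And>i j. rf_stable (N $ i $ j)" "Re s \<ge> 0"
  shows "tf_eval (M ** N) s = tf_eval M s ** tf_eval N s"
  using assms by (simp add: vec_eq_iff tf_eval_def matrix_matrix_mult_def rf_eval_sum rf_stable_mult rf_eval_mult)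

lemma rf_stable_matrix_mult:
  fixes M N :: "ratfun ^ 'n ^ 'n::finite"
  assumes "\<And>i j. rf_stable (M $ i $ j)" "\<And>i j. rf_stable (N $ i $ j)"
  shows "rf_stable ((M ** N) $ i $ j)"
  using assms by (simp add: matrix_matrix_mult_def rf_stable_sum rf_stable_mult)

lemma to_fract_const: "to_fract [:c:] = Fract [:c:] 1"
  by (simp add: to_fract_def)

text \<open>Integer constants lie in every family and evaluate to themselves; in this form those
  facts cover the identity matrix.\<close>

lemma mat_1_fract: "(mat 1 :: ratfun ^ 'n ^ 'n::finite) $ i $ j = of_int (of_bool (i = j))"
  by (simp add: mat_def)

lemma tf_scale_stable:
  fixes H :: "ratfun ^ 'n ^ 'n::finite"
  assumes "\<And>i j. rf_stable (H $ i $ j)"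
  shows "rf_stable (tf_scale t H $ i $ j)"
  using assms by (simp add: tf_scale_def to_fract_const rf_stable_mult rf_stable_const)

text \<open>Stability of the entries lets evaluation pass through the matrix operations. This links
  the rational loop to the complex matrices whose graphs are compared.\<close>

lemma tf_eval_loop:
  fixes G H :: "ratfun ^ 'n ^ 'n::finite"
  assumes G: "\<And>i j. rf_stable (G $ i $ j)" and H: "\<And>i j. rf_stable (H $ i $ j)" and s: "Re s \<ge> 0"
  shows "tf_eval (mat 1 + tf_scale t H ** G) s = mat 1 + t *\<^sub>R (tf_eval H s ** tf_eval G s)"
proof -
  have "tf_eval (tf_scale t H) s = t *\<^sub>R tf_eval H s"
    using H s by (simp add: vec_eq_iff tf_eval_def tf_scale_def to_fract_const rf_eval_mult rf_stable_const rf_eval_const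
        scaleR_conv_of_real[of t "_ :: complex"])
  then have *: "tf_eval (tf_scale t H ** G) s = t *\<^sub>R (tf_eval H s ** tf_eval G s)"
    using tf_eval_mult[OF tf_scale_stable[of H t, OF H] G s] by (simp add: scalar_matrix_assoc)
  have "tf_eval (mat 1 + tf_scale t H ** G) s = mat 1 + tf_eval (tf_scale t H ** G) s"
    using s rf_stable_matrix_mult[OF tf_scale_stable[of H t, OF H] G]
    by (simp add: vec_eq_iff tf_eval_def mat_1_fract rf_eval_add rf_stable_of_int rf_eval_of_int
        del: of_int_of_bool) (simp add: mat_def)
  with * show ?thesis by simp
qed

context denominators
begin

lemma family_matrix_mult:
  fixes M N :: "real \<Rightarrow> ratfun ^ 'n ^ 'n::finite"
  assumes "\<And>i j. family (\<lambda>t. M t $ i $ j)" "\<And>i j. family (\<lambda>t. N t $ i $ j)"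
  shows "family (\<lambda>t. (M t ** N t) $ i $ j)"
  using assms by (simp add: matrix_matrix_mult_def family_sum family_mult)

text \<open>The parameter enters only through the constant factor in \<open>tf_scale\<close>, so one
  denominator serves all t.\<close>

lemma family_loop:
  fixes G H :: "ratfun ^ 'n ^ 'n::finite"
  assumes "\<And>i j. family (\<lambda>_. G $ i $ j)" "\<And>i j. family (\<lambda>_. H $ i $ j)"
  shows "family (\<lambda>t. (mat 1 + tf_scale t H ** G) $ i $ j)"
proof -
  have "family (\<lambda>t. tf_scale t H $ i $ j)" for i j
    using assms by (simp add: tf_scale_def to_fract_const family_mult family_of_constants)
  then show ?thesis
    unfolding vector_add_component mat_1_fract
    using assms by (intro family_add family_of_int family_matrix_mult) auto
qed

end

section \<open>Inverse matrices and singular loops\<close>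

lemma matrix_inv_mult:
  fixes A :: "'a::semiring_1 ^ 'n ^ 'n::finite"
  assumes "invertible A"
  shows "A ** matrix_inv A = mat 1" "matrix_inv A ** A = mat 1"
  using someI_ex[OF assms[unfolded invertible_def]] by (auto simp: matrix_inv_def)

text \<open>Column l of the inverse solves A x = e_l, so Cramer's rule replaces column k of A by
  e_l. The entries of e_l are written as integers, which lie in every family.\<close>

lemma matrix_inv_entry:
  fixes A :: "'a::field ^ 'n ^ 'n::finite"
  assumes "invertible A"
  shows "matrix_inv A $ k $ l = det (\<chi> i j. if j = k then of_int (of_bool (i = l)) else A $ i $ j) / det A"
proof -
  have "A *v column l (matrix_inv A) = axis l 1"
    using matrix_inv_mult(1)[OF assms]
    by (simp add: vec_eq_iff matrix_vector_mult_def matrix_matrix_mult_def column_def axis_def mat_def)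
  then show ?thesis
    using cramer[of A "column l (matrix_inv A)" "axis l 1"] assms
    by (simp add: invertible_det_nz vec_eq_iff column_def axis_def of_bool_def if_distrib cong: if_cong)
qed

text \<open>On a normalized kernel vector both matrices take the same value, so its quadratic forms
  and image norms agree.\<close>

lemma singular_loop_xz_graphs_meet:
  fixes G H :: "complex ^ 'n ^ 'n::finite"
  assumes H: "invertible H" and t: "t \<noteq> 0" and det: "det (mat 1 + t *\<^sub>R (H ** G)) = 0"
  shows "xz_graph G \<inter> xz_graph ((- (1 / t)) *\<^sub>R matrix_inv H) \<noteq> {}"
proof -
  let ?K = "(- (1 / t)) *\<^sub>R matrix_inv H"
  have "\<not> invertible (mat 1 + t *\<^sub>R (H ** G))"
    using det by (simp add: invertible_det_nz)
  then obtain y where y: "(mat 1 + t *\<^sub>R (H ** G)) *v y = 0" "y \<noteq> 0"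
    unfolding invertible_left_inverse matrix_left_invertible_ker by blast
  have scale: "(c *\<^sub>R A) *v v = c *\<^sub>R (A *v v)" "A *v (c *\<^sub>R v) = c *\<^sub>R (A *v v)" for c and A :: "complex ^ 'n ^ 'n" and v
    by (simp_all add: vec_eq_iff matrix_vector_mult_def scaleR_sum_right)
  define x where "x = (1 / norm y) *\<^sub>R y"
  have x: "norm x = 1" using y by (simp add: x_def)
  have "(mat 1 + t *\<^sub>R (H ** G)) *v x = 0"
    using y by (simp add: x_def scale)
  then have "x + t *\<^sub>R (H *v (G *v x)) = 0"
    by (simp add: matrix_vector_mult_add_rdistrib scale matrix_vector_mul_assoc)
  then have "matrix_inv H *v (x + t *\<^sub>R (H *v (G *v x))) = 0" by simp
  then have "matrix_inv H *v x + t *\<^sub>R (G *v x) = 0"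
    using matrix_inv_mult(2)[OF H]
    by (simp add: matrix_vector_right_distrib scale matrix_vector_mul_assoc matrix_mul_assoc)
  then have "t *\<^sub>R (G *v x) = - (matrix_inv H *v x)"
    by (simp add: add_eq_0_iff)
  then have "(1 / t) *\<^sub>R (t *\<^sub>R (G *v x)) = (1 / t) *\<^sub>R (- (matrix_inv H *v x))" by (rule arg_cong)
  then have "G *v x = ?K *v x"
    using t unfolding scale by simp
  then have "(Re (quad_form G x), (norm (G *v x))\<^sup>2) = (Re (quad_form ?K x), (norm (?K *v x))\<^sup>2)"
    by (simp add: quad_form_def)
  moreover have "(Re (quad_form G x), (norm (G *v x))\<^sup>2) \<in> xz_graph G"
    "(Re (quad_form ?K x), (norm (?K *v x))\<^sup>2) \<in> xz_graph ?K"
    using x unfolding xz_graph_def by blast+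
  ultimately show ?thesis by (metis disjoint_iff)
qed

lemma xz_graph_of_DW: "(z, r) \<in> DW A \<Longrightarrow> (Re z, r) \<in> xz_graph A"
  by (auto simp: DW_def xz_graph_def)

text \<open>Taking real parts in the first coordinate sends a common point of the shells to a common
  point of the graphs.\<close>

lemma DW_disjoint_of_xz_graph_disjoint:
  "xz_graph A \<inter> xz_graph B = {} \<Longrightarrow> DW A \<inter> DW B = {}"
  using xz_graph_of_DW[of _ _ A] xz_graph_of_DW[of _ _ B] by fast

text \<open>Well-posedness excludes a loss of degree, i.e. a zero of the determinant at infinity, because
  the determinant of the proper inverse is proper again.\<close>

lemma degree_det_of_proper_inverse:
  fixes A :: "ratfun ^ 'n ^ 'n::finite"
  assumes inv: "invertible A" and proper: "\<And>i j. rf_proper (matrix_inv A $ i $ j)"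
    and det: "det A = Fract p q" and q: "q \<noteq> 0" and deg: "degree p \<le> degree q"
  shows "p \<noteq> 0" "degree p = degree q"
proof -
  have "proper.family (\<lambda>_. det (matrix_inv A))"
    by (rule proper.family_det) (simp add: proper_const_iff proper)
  then obtain c d where cd: "d \<noteq> 0" "degree c \<le> degree d" "det (matrix_inv A) = Fract c d"
    by (auto simp: proper.family_const_iff)
  have "det A * det (matrix_inv A) = 1"
    using matrix_inv_mult(1)[OF inv] det_mul[of A "matrix_inv A"] by simp
  \<comment> \<open>Both numerators have at most the degree of their denominators; comparing degrees
    in this identity forces equality in both.\<close>
  then have eq: "p * c = q * d"
    using q cd by (simp add: det One_fract_def eq_fract)
  then have nz: "p \<noteq> 0" "c \<noteq> 0" using q cd by auto
  then have "degree p + degree c = degree q + degree d"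
    using eq q cd by (metis degree_mult_eq)
  then show "p \<noteq> 0" "degree p = degree q" using nz deg cd by auto
qed

text \<open>The inverse determinant q / p is itself proper and stable. Cramer's rule gives each
  entry of the inverse as a determinant of proper stable entries times q / p, and the four feedback
  blocks are products of such matrices.\<close>

lemma closed_loop_stable_of_hurwitz:
  fixes G H :: "ratfun ^ 'n ^ 'n::finite"
  assumes G: "G \<in> RH_inf" and H: "H \<in> RH_inf"
    and det: "det (mat 1 + H ** G) = Fract p q"
    and p: "hurwitz p" and q: "q \<noteq> 0" "degree q \<le> degree p"
  shows "closed_loop_stable G H"
proof -
  let ?A = "mat 1 + H ** G"
  let ?S = "matrix_inv ?A"
  have G': "RH.family (\<lambda>_. G $ i $ j)" and H': "RH.family (\<lambda>_. H $ i $ j)" for i j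
    using G H by (auto simp: RH_const_iff RH_inf_def)
  have A: "RH.family (\<lambda>_. ?A $ i $ j)" for i j
    unfolding vector_add_component mat_1_fract
    by (intro RH.family_add RH.family_of_int RH.family_matrix_mult G' H')
  have inv: "invertible ?A"
    using p q hurwitz_nonzero by (simp add: invertible_det_nz det Zero_fract_def eq_fract)
  have "RH.family (\<lambda>_. Fract q p)"
    using p q by (auto simp: RH.family_const_iff)
  moreover have "?S $ k $ l = det (\<chi> i j. if j = k then of_int (of_bool (i = l)) else ?A $ i $ j) * Fract q p" for k l
    unfolding matrix_inv_entry[OF inv] det by (simp add: divide_inverse)
  moreover have "RH.family (\<lambda>_. det (\<chi> i j. if j = k then of_int (of_bool (i = l)) else ?A $ i $ j))" for k l
    by (rule RH.family_det) (use A RH.family_of_int[of 0] RH.family_of_int[of 1] in \<open>auto simp del: vector_add_component\<close>)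
  ultimately have S: "RH.family (\<lambda>_. ?S $ i $ j)" for i j
    by (simp only: RH.family_mult)
  have "RH.family (\<lambda>_. feedback G H $ i $ j)" for i j
    using S G' H' unfolding feedback_def Let_def block_matrix_def
    by (cases i; cases j) (auto intro!: RH.family_matrix_mult)
  with inv show ?thesis
    by (simp add: closed_loop_stable_def RH_inf_def RH_const_iff)
qed

text \<open>Separation at finite frequencies says nothing about infinity, which
  \<open>well_posed\<close> controls for every \<tau>. Invertibility at each frequency is stated
  because \<open>matrix_inv\<close> is unspecified on singular matrices.\<close>

theorem lemma4p3:
  fixes G H :: "ratfun ^ 'm ^ 'm::finite"
  assumes "G \<in> RH_inf" and "H \<in> RH_inf" and "invertible H"
  shows
    "((\<forall>\<tau>\<in>{0<..1}. well_posed G (tf_scale \<tau> H)) \<longrightarrow>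
      (\<forall>\<omega>::real. \<omega> \<ge> 0 \<longrightarrow>
         invertible (tf_eval H (\<i> * of_real \<omega>)) \<and>
         (\<forall>\<tau>\<in>{0<..1}.
            xz_graph (tf_eval G (\<i> * of_real \<omega>)) \<inter>
            xz_graph ((- (1 / \<tau>)) *\<^sub>R matrix_inv (tf_eval H (\<i> * of_real \<omega>))) = {})) \<longrightarrow>
      closed_loop_stable G H) \<and>
     (\<forall>\<omega>::real. \<omega> \<ge> 0 \<longrightarrow>
        invertible (tf_eval H (\<i> * of_real \<omega>)) \<longrightarrow>
        (\<forall>\<tau>\<in>{0<..1}.
            xz_graph (tf_eval G (\<i> * of_real \<omega>)) \<inter>
            xz_graph ((- (1 / \<tau>)) *\<^sub>R matrix_inv (tf_eval H (\<i> * of_real \<omega>))) = {}) \<longrightarrow>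
        (\<forall>\<tau>\<in>{0<..1}.
            DW (tf_eval G (\<i> * of_real \<omega>)) \<inter>
            DW ((- (1 / \<tau>)) *\<^sub>R matrix_inv (tf_eval H (\<i> * of_real \<omega>))) = {}))"
proof (intro conjI impI)
  assume wp: "\<forall>\<tau>\<in>{0<..1}. well_posed G (tf_scale \<tau> H)"
    and sep: "\<forall>\<omega>::real. \<omega> \<ge> 0 \<longrightarrow>
         invertible (tf_eval H (\<i> * of_real \<omega>)) \<and>
         (\<forall>\<tau>\<in>{0<..1}.
            xz_graph (tf_eval G (\<i> * of_real \<omega>)) \<inter>
            xz_graph ((- (1 / \<tau>)) *\<^sub>R matrix_inv (tf_eval H (\<i> * of_real \<omega>))) = {})"
  define A where "A t = mat 1 + tf_scale t H ** G" for t
  have stable: "rf_stable (G $ i $ j)" "rf_stable (H $ i $ j)" for i j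
    using assms by (auto simp: RH_inf_def)
  have fam: "RH.family (\<lambda>t. A t $ i $ j)" for i j
    unfolding A_def using assms by (intro RH.family_loop) (auto simp: RH_inf_def RH_const_iff)
  then have "RH.family (\<lambda>t. det (A t))" by (rule RH.family_det)
  then obtain p q where q: "hurwitz q" and cont: "\<And>n. continuous_on UNIV (\<lambda>t. coeff (p t) n)"
    and deg: "\<And>t. degree (p t) \<le> degree q" and det: "\<And>t. det (A t) = Fract (p t) q"
    unfolding RH.family_def by blast
  have q0: "q \<noteq> 0" using q by (rule hurwitz_nonzero)
  \<comment> \<open>The hypotheses cover only \<tau> > 0. At t = 0 the loop is the identity with
    determinant 1, so \<open>p 0 = q\<close> and the homotopy starts at a Hurwitz
    polynomial.\<close>
  have "tf_scale 0 H = 0" and tf1: "tf_scale 1 H = H"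
    by (simp_all add: vec_eq_iff tf_scale_def to_fract_def fract_collapse flip: one_pCons)
  then have "det (A 0) = 1"
    by (simp add: A_def)
  then have p_0: "p 0 = q"
    using det[of 0] q0 by (simp add: One_fract_def eq_fract)
  have full: "p t \<noteq> 0 \<and> degree (p t) = degree q" if t: "t \<in> {0..1}" for t
  proof (cases "t = 0")
    case False
    then have "well_posed G (tf_scale t H)" using wp t by auto
    then show ?thesis
      using degree_det_of_proper_inverse[OF _ _ det q0 deg, of t] by (auto simp: well_posed_def A_def)
  qed (simp add: p_0 q0)
  have axis: "poly (cpoly (p t)) s \<noteq> 0" if t: "t \<in> {0..1}" and s: "Re s = 0" for t s
  proof (cases "t = 0")
    case True
    then show ?thesis using q s by (simp add: p_0 hurwitz_def)
  next
    case False
    have nonneg: "poly (cpoly (p t)) (\<i> * of_real w) \<noteq> 0" if w: "w \<ge> 0" for w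
    proof
      let ?s = "\<i> * complex_of_real w"
      assume "poly (cpoly (p t)) ?s = 0"
      \<comment> \<open>As q does not vanish here, a zero of \<open>p t\<close> is not cancelled and
        makes the evaluated determinant zero.\<close>
      moreover have "poly (cpoly q) ?s \<noteq> 0" using q by (simp add: hurwitz_def)
      ultimately have "rf_eval (det (A t)) ?s = 0"
        by (simp add: det rf_eval_Fract)
      moreover have "rf_stable (A t $ i $ j)" for i j
        unfolding A_def vector_add_component mat_1_fract
        by (intro rf_stable_add rf_stable_of_int rf_stable_matrix_mult tf_scale_stable stable)
      ultimately have "det (tf_eval (A t) ?s) = 0"
        by (simp add: rf_eval_det)
      then have "det (mat 1 + t *\<^sub>R (tf_eval H ?s ** tf_eval G ?s)) = 0"
        using stable by (simp add: A_def tf_eval_loop)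
      from singular_loop_xz_graphs_meet[OF _ False this] show False
        using sep w t False by auto
    qed
    show ?thesis
    proof (cases "Im s \<ge> 0")
      case True
      have "s = \<i> * of_real (Im s)" using s by (simp add: complex_eq_iff)
      with nonneg[OF True] show ?thesis by simp
    next
      case False
      have "cnj s = \<i> * of_real (- Im s)" using s by (simp add: complex_eq_iff)
      then have "poly (cpoly (p t)) (cnj s) \<noteq> 0" using nonneg[of "- Im s"] False by simp
      then show ?thesis by (simp add: poly_cpoly_cnj)
    qed
  qed
  have "poly (cpoly (p 1)) s \<noteq> 0" if "0 \<le> Re s" for s
  proof (rule hurwitz_homotopy[of "\<lambda>t. cpoly (p t)" "degree q", OF _ _ _ _ that])
    show "continuous_on {0..1} (\<lambda>t. coeff (cpoly (p t)) n)" for n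
      using continuous_on_subset[OF cont, of "{0..1}"] by (auto simp: coeff_map_poly intro!: continuous_intros)
    show "cpoly (p t) \<noteq> 0 \<and> degree (cpoly (p t)) = degree q" if "t \<in> {0..1}" for t
      using full[OF that] by (simp add: map_poly_eq_0_iff)
    show "poly (cpoly (p 0)) s \<noteq> 0" if "0 \<le> Re s" for s
      using q that by (simp add: p_0 hurwitz_def)
  qed (rule axis)
  then have "hurwitz (p 1)" by (simp add: hurwitz_def)
  \<comment> \<open>By \<open>full\<close> at t = 1 the degrees of \<open>p 1\<close> and q agree,
    which makes q / p 1 proper.\<close>
  then show "closed_loop_stable G H"
    using det[of 1] full[of 1] q0 assms(1,2)
    by (intro closed_loop_stable_of_hurwitz[where p = "p 1" and q = q]) (auto simp: A_def tf1)
qed (use DW_disjoint_of_xz_graph_disjoint in metis)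

end
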